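(* Let $A$ be an out-arborescence with $n$ nodes, $k$ out-leaves and root $r$, let $T$ be a tournament on $m=n+k-1$ vertices, and let $\sigma=(v_1,v_2,\ldots,v_m)$ be a local median order of $T$. Then there is an embedding $\phi$ of $A$ in $T$ (an injective map $V(A)\to V(T)$ sending every arc $uv$ of $A$ to an arc $\phi(u)\phi(v)$ of $T$) such that $\phi(r)=v_1$.
   Context: A tournament is an orientation of a complete graph; $u$ dominates $v$ if $uv$ is an arc. An out-arborescence is an oriented tree in which all arcs are oriented away from a fixed vertex, the root. An out-leaf is a node of in-degree $1$ and out-degree $0$. A local median order of a tournament $T$ is an ordering $(v_1,\dots,v_m)$ of its vertices such that for all $1\le i<j\le m$, the vertex $v_i$ dominates at least half of the vertices $v_{i+1},\dots,v_j$, and $v_j$ is dominated by at least half of the vertices $v_i,\dots,v_{j-1}$. *)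

theory Defs
  imports "Graph_Theory.Graph_Theory"
begin

text \<open>
  Simple digraphs are \<open>pair_digraph\<close>s: finite, without loops or parallel arcs.  The
  underlying graph of \<open>G\<close> is the symmetric digraph \<open>mk_symmetric G\<close>, and \<open>G\<close> is an orientation
  of it when \<open>G\<close> does not contain both an arc and its reverse.
\<close>

definition oriented_graph :: "'a pair_pre_digraph \<Rightarrow> bool" where
  "oriented_graph G \<longleftrightarrow> pair_digraph G \<and> (\<forall>u v. (u, v) \<in> parcs G \<longrightarrow> (v, u) \<notin> parcs G)"

definition tournament_on :: "nat \<Rightarrow> 'a pair_pre_digraph \<Rightarrow> bool" where
  "tournament_on m T \<longleftrightarrow> oriented_graph T \<and> complete_digraph m (with_proj (mk_symmetric T))"

text \<open>
  The library's \<open>tree\<close> is not usable here: its \<open>forest\<close> only excludes directed cycles.  A cycle of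
  the underlying graph is a cycle of \<open>mk_symmetric G\<close> of length at least 3, since traversing an
  edge back and forth is a cycle of length 2 in a symmetric digraph.
\<close>

definition oriented_tree :: "'a pair_pre_digraph \<Rightarrow> bool" where
  "oriented_tree G \<longleftrightarrow> oriented_graph G \<and> connected (with_proj G) \<and>
     \<not> (\<exists>p. pre_digraph.cycle (with_proj (mk_symmetric G)) p \<and> 3 \<le> length p)"

text \<open>
  An arc \<open>(u, v)\<close> is oriented away from \<open>r\<close> if the path of the underlying tree that starts in \<open>r\<close>
  and ends with the corresponding edge traverses it from \<open>u\<close> to \<open>v\<close>.
\<close>

definition out_arborescence :: "'a pair_pre_digraph \<Rightarrow> 'a \<Rightarrow> bool" where
  "out_arborescence A r \<longleftrightarrow> oriented_tree A \<and> r \<in> pverts A \<and>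
     (\<forall>u v. (u, v) \<in> parcs A \<longrightarrow>
        (\<exists>p. pre_digraph.apath (with_proj (mk_symmetric A)) r (p @ [(u, v)]) v))"

definition out_leaves :: "'a pair_pre_digraph \<Rightarrow> 'a set" where
  "out_leaves A = {v \<in> pverts A. in_degree (with_proj A) v = 1 \<and> out_degree (with_proj A) v = 0}"

text \<open>
  Orderings are lists indexed from 0, so the first vertex is \<open>\<sigma> ! 0\<close>.
\<close>

definition local_median_order :: "'a pair_pre_digraph \<Rightarrow> 'a list \<Rightarrow> bool" where
  "local_median_order T \<sigma> \<longleftrightarrow> distinct \<sigma> \<and> set \<sigma> = pverts T \<and>
     (\<forall>i j. i < j \<and> j < length \<sigma> \<longrightarrow>
        real (card {l \<in> {i<..j}. (\<sigma> ! i, \<sigma> ! l) \<in> parcs T}) \<ge> real (card {i<..j}) / 2 \<and>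
        real (card {l \<in> {i..<j}. (\<sigma> ! l, \<sigma> ! j) \<in> parcs T}) \<ge> real (card {i..<j}) / 2)"

definition embedding :: "'a pair_pre_digraph \<Rightarrow> 'b pair_pre_digraph \<Rightarrow> ('a \<Rightarrow> 'b) \<Rightarrow> bool" where
  "embedding A T \<phi> \<longleftrightarrow> \<phi> ` pverts A \<subseteq> pverts T \<and> inj_on \<phi> (pverts A) \<and>
     (\<forall>u v. (u, v) \<in> parcs A \<longrightarrow> (\<phi> u, \<phi> v) \<in> parcs T)"

end

theory Submission
  imports Defs
begin

text \<open>
  Scan the tournament along the median order and give each vertex \<open>v\<^sub>l\<close> to a missing child of the
  first embedded node that dominates \<open>v\<^sub>l\<close> and still misses a child; if there is no such node,
  \<open>v\<^sub>l\<close> is skipped.  Suppose this ends with a partial embedding.  For a skipped \<open>v\<^sub>j\<close> let \<open>v\<^sub>i\<close>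
  be the last vertex before \<open>v\<^sub>j\<close> that still misses a child.  At least half of
  \<open>v\<^sub>i\<^sub>+\<^sub>1, \<dots>, v\<^sub>j\<close> are dominated by \<open>v\<^sub>i\<close>; all of these are used, by nodes whose parents
  come no later than \<open>v\<^sub>i\<close>.  By the choice of \<open>i\<close> the whole branches of these nodes lie
  between \<open>v\<^sub>i\<close> and \<open>v\<^sub>j\<close>, so that this stretch contains at least as many leaves as skipped
  vertices.  Hence at most as many vertices are skipped as leaves are embedded, which leaves at
  most \<open>(n - 1) + (k - 1)\<close> vertices of the tournament.
\<close>

section \<open>Rooted trees\<close>

locale rooted_tree =
  fixes V :: "'a set" and E :: "'a rel" and r :: 'a
  assumes finite_V: "finite V"
    and E_subset: "E \<subseteq> V \<times> V"
    and root_in_V: "r \<in> V"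
    and reachable_from_root: "v \<in> V \<Longrightarrow> (r, v) \<in> E\<^sup>*"
    and parent_unique: "(u, v) \<in> E \<Longrightarrow> (u', v) \<in> E \<Longrightarrow> u = u'"
    and root_no_parent: "(u, r) \<notin> E"
begin

text \<open>In a rooted tree the in-degree is 1 exactly off the root, so \<open>z \<noteq> r\<close>
  stands for the in-degree condition on out-leaves; a root on its own is not a leaf.\<close>

definition leaves :: "'a set" where
  "leaves = {z \<in> V. z \<noteq> r \<and> (\<forall>c. (z, c) \<notin> E)}"

lemma finite_leaves: "finite leaves"
  unfolding leaves_def using finite_V by simp

text \<open>A cycle through a node also runs through its unique parent. It can thus be pushed back
  along the path from the root, but nothing enters \<open>r\<close>.\<close>

lemma no_cycle_at_descendant_of_root: "(r, v) \<in> E\<^sup>* \<Longrightarrow> (v, v) \<notin> E\<^sup>+"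
proof (induction rule: rtrancl_induct)
  case base
  show ?case using root_no_parent by (metis tranclE)
next
  case (step y z)
  show ?case
  proof
    assume "(z, z) \<in> E\<^sup>+"
    then obtain w where "(z, w) \<in> E\<^sup>*" "(w, z) \<in> E"
      by (meson tranclD2)
    with step.hyps(2) have "(y, y) \<in> E\<^sup>+"
      by (metis parent_unique rtrancl_into_trancl2)
    with step.IH show False by simp
  qed
qed

lemma wf_converse_E: "wf (E\<inverse>)"
proof (rule finite_acyclic_wf_converse)
  show "finite E"
    using finite_subset[OF E_subset] finite_V by simp
  show "acyclic E"
  proof (rule acyclicI, intro allI notI)
    fix v assume v: "(v, v) \<in> E\<^sup>+"
    then have "v \<in> V" using E_subset by (meson tranclD SigmaD1 subsetD)
    then show False using v reachable_from_root no_cycle_at_descendant_of_root by blast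
  qed
qed

lemma ex_leaf_below:
  assumes "v \<in> V" "v \<noteq> r"
  shows "\<exists>z \<in> leaves. (v, z) \<in> E\<^sup>*"
  using wf_converse_E assms
proof (induction v rule: wf_induct_rule)
  case (less v)
  show ?case
  proof (cases "\<exists>c. (v, c) \<in> E")
    case True
    then obtain c where c: "(v, c) \<in> E" by blast
    then have "c \<in> V" "c \<noteq> r" using E_subset root_no_parent by auto
    with less.IH[of c] c show ?thesis by (auto intro: converse_rtrancl_into_rtrancl)
  next
    case False
    with less.prems show ?thesis by (auto simp: leaves_def)
  qed
qed

text \<open>Climbing from \<open>z\<close> is deterministic because parents are unique, so of two
  climbs one extends the other.\<close>

lemma ancestors_comparable:
  assumes "(a, z) \<in> E\<^sup>*" "(b, z) \<in> E\<^sup>*"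
  shows "(a, b) \<in> E\<^sup>* \<or> (b, a) \<in> E\<^sup>*"
proof -
  have "single_valued (E\<inverse>)"
    by (auto simp: single_valued_def intro: parent_unique)
  from single_valued_confluent[OF this, of z a b] assms
  show ?thesis by (auto simp: rtrancl_converse)
qed

lemma proper_part_has_missing_child:
  assumes "P \<subseteq> V" "r \<in> P" "P \<noteq> V"
  shows "\<exists>x \<in> P. \<exists>c. (x, c) \<in> E \<and> c \<notin> P"
proof (rule ccontr)
  assume "\<not> ?thesis"
  then have closed: "\<And>x c. x \<in> P \<Longrightarrow> (x, c) \<in> E \<Longrightarrow> c \<in> P" by blast
  have "v \<in> P" if "(r, v) \<in> E\<^sup>*" for v
    using that by (induction rule: rtrancl_induct) (use assms closed in auto)
  then show False using assms reachable_from_root by blast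
qed

section \<open>The greedy embedding\<close>

text \<open>
  \<open>D i l\<close> means that the \<open>i\<close>th vertex dominates the \<open>l\<close>th one.  The last clause is the greedy
  rule: if \<open>x\<close> dominates \<open>l\<close> and still misses a child when \<open>l\<close> is processed, then \<open>l\<close> is used for
  a child of \<open>x\<close> or of a node before \<open>x\<close>.
\<close>

definition greedy :: "(nat \<Rightarrow> nat \<Rightarrow> bool) \<Rightarrow> 'a set \<Rightarrow> ('a \<Rightarrow> nat) \<Rightarrow> nat \<Rightarrow> bool" where
  "greedy D H f j \<longleftrightarrow> H \<subseteq> V \<and> r \<in> H \<and> f r = 0 \<and> inj_on f H \<and> f ` H \<subseteq> {..<j} \<and>
     (\<forall>u v. (u, v) \<in> E \<and> v \<in> H \<longrightarrow> u \<in> H \<and> f u < f v \<and> D (f u) (f v)) \<and>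
     (\<forall>x l. x \<in> H \<and> l < j \<and> f x < l \<and> D (f x) l \<and> (\<exists>c. (x, c) \<in> E \<and> \<not> (c \<in> H \<and> f c < l)) \<longrightarrow>
        (\<exists>u y. (u, y) \<in> E \<and> y \<in> H \<and> f y = l \<and> f u \<le> f x))"

lemma greedyD:
  assumes "greedy D H f j"
  shows "H \<subseteq> V" "r \<in> H" "f r = 0" "inj_on f H" "x \<in> H \<Longrightarrow> f x < j"
    and "(u, v) \<in> E \<Longrightarrow> v \<in> H \<Longrightarrow> u \<in> H"
    and "(u, v) \<in> E \<Longrightarrow> v \<in> H \<Longrightarrow> f u < f v"
    and "(u, v) \<in> E \<Longrightarrow> v \<in> H \<Longrightarrow> D (f u) (f v)"
    and "x \<in> H \<Longrightarrow> l < j \<Longrightarrow> f x < l \<Longrightarrow> D (f x) l \<Longrightarrow> (x, c) \<in> E \<Longrightarrow> \<not> (c \<in> H \<and> f c < l) \<Longrightarrow>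
      \<exists>u y. (u, y) \<in> E \<and> y \<in> H \<and> f y = l \<and> f u \<le> f x"
  using assms unfolding greedy_def by blast+

lemma greedy_initial: "greedy D {r} (\<lambda>_. 0) (Suc 0)"
  unfolding greedy_def using root_in_V root_no_parent by auto

lemma greedy_skip:
  assumes g: "greedy D H f j"
    and none: "\<And>x c. x \<in> H \<Longrightarrow> D (f x) j \<Longrightarrow> (x, c) \<in> E \<Longrightarrow> c \<in> H"
  shows "greedy D H f (Suc j)"
  unfolding greedy_def
proof (intro conjI allI impI)
  show "f ` H \<subseteq> {..<Suc j}"
    using greedyD(5)[OF g] by (auto simp: less_Suc_eq)
next
  fix x l
  assume a: "x \<in> H \<and> l < Suc j \<and> f x < l \<and> D (f x) l \<and> (\<exists>c. (x, c) \<in> E \<and> \<not> (c \<in> H \<and> f c < l))"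
  then obtain c where c: "(x, c) \<in> E" "\<not> (c \<in> H \<and> f c < l)" by blast
  have "l \<noteq> j" using a c none greedyD(5)[OF g] by blast
  then have "l < j" using a by simp
  with a c greedyD(9)[OF g] show "\<exists>u y. (u, y) \<in> E \<and> y \<in> H \<and> f y = l \<and> f u \<le> f x" by blast
qed (use greedyD[OF g] in blast)+

lemma greedy_extend:
  assumes g: "greedy D H f j"
    and x: "x \<in> H" "D (f x) j" "(x, c) \<in> E" "c \<notin> H"
    and first: "\<And>x' c'. x' \<in> H \<Longrightarrow> D (f x') j \<Longrightarrow> (x', c') \<in> E \<Longrightarrow> c' \<notin> H \<Longrightarrow> f x \<le> f x'"
  shows "greedy D (insert c H) (f(c := j)) (Suc j)"
  unfolding greedy_def
proof (intro conjI allI impI)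
  show "insert c H \<subseteq> V" using greedyD(1)[OF g] x E_subset by auto
  show "r \<in> insert c H" using greedyD(2)[OF g] by simp
  show "(f(c := j)) r = 0" using greedyD(2,3)[OF g] x by auto
  show "(f(c := j)) ` insert c H \<subseteq> {..<Suc j}"
    using greedyD(5)[OF g] by (auto simp: less_Suc_eq)
  show "inj_on (f(c := j)) (insert c H)"
  proof -
    have "inj_on (f(c := j)) H"
      using inj_on_fun_updI[OF greedyD(4)[OF g], of j c] greedyD(5)[OF g] by blast
    moreover have "j \<notin> (f(c := j)) ` H" using greedyD(5)[OF g] x by auto
    ultimately show ?thesis using x by simp
  qed
next
  fix u v assume uv: "(u, v) \<in> E \<and> v \<in> insert c H"
  have "u \<noteq> c \<and> u \<in> H \<and> f u < (f(c := j)) v \<and> D (f u) ((f(c := j)) v)"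
  proof (cases "v = c")
    case True
    with uv x parent_unique have "u = x" by blast
    with True x greedyD(5)[OF g] show ?thesis by auto
  next
    case False
    with uv x greedyD(6,7,8)[OF g] show ?thesis by auto
  qed
  then show "u \<in> insert c H" "(f(c := j)) u < (f(c := j)) v" "D ((f(c := j)) u) ((f(c := j)) v)"
    by auto
next
  fix x' l
  assume a: "x' \<in> insert c H \<and> l < Suc j \<and> (f(c := j)) x' < l \<and> D ((f(c := j)) x') l \<and>
    (\<exists>c'. (x', c') \<in> E \<and> \<not> (c' \<in> insert c H \<and> (f(c := j)) c' < l))"
  then have x': "x' \<in> H" "x' \<noteq> c" "f x' < l" "D (f x') l" "l \<le> j"
    by (auto split: if_splits)
  from a obtain c' where c': "(x', c') \<in> E" "\<not> (c' \<in> insert c H \<and> (f(c := j)) c' < l)" by blast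
  show "\<exists>u y. (u, y) \<in> E \<and> y \<in> insert c H \<and> (f(c := j)) y = l \<and> (f(c := j)) u \<le> (f(c := j)) x'"
  proof (cases "l = j")
    case True
    \<comment> \<open>All of \<open>H\<close> sits before \<open>j\<close>, so a child still missing
      at time \<open>j\<close> lies outside \<open>H\<close>; then \<open>x'\<close> competed with
      \<open>x\<close> for position \<open>j\<close>, and \<open>first\<close> applies.\<close>
    with c' x greedyD(5)[OF g] have "c' \<notin> H" by (auto split: if_splits)
    with first x' c' True have "f x \<le> f x'" by blast
    with x x' True show ?thesis by (intro exI[of _ x] exI[of _ c]) auto
  next
    case False
    \<comment> \<open>The new node \<open>c\<close> sits at \<open>j > l\<close>, so what was
      missing at time \<open>l\<close> is unchanged and the old greedy rule still applies.\<close>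
    with c' x x' have "\<not> (c' \<in> H \<and> f c' < l)" by (auto split: if_splits)
    with greedyD(9)[OF g] x' c' False obtain u y
      where "(u, y) \<in> E" "y \<in> H" "f y = l" "f u \<le> f x'" by (metis le_neq_implies_less)
    moreover have "u \<noteq> c" "y \<noteq> c" using calculation greedyD(6)[OF g] x by auto
    ultimately show ?thesis using x' by (intro exI[of _ u] exI[of _ y]) auto
  qed
qed

lemma greedy_exists:
  assumes "1 \<le> j"
  shows "\<exists>H f. greedy D H f j"
  using assms
proof (induction j rule: dec_induct)
  case base
  then show ?case using greedy_initial by fastforce
next
  case (step j)
  then obtain H f where g: "greedy D H f j" by blast
  let ?Q = "\<lambda>x. x \<in> H \<and> D (f x) j \<and> (\<exists>c. (x, c) \<in> E \<and> c \<notin> H)"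
  show ?case
  proof (cases "\<exists>x. ?Q x")
    case True
    then obtain x where x: "?Q x" and first: "\<And>y. ?Q y \<Longrightarrow> f x \<le> f y"
      using ex_has_least_nat[of ?Q _ f] by blast
    from x obtain c where "(x, c) \<in> E" "c \<notin> H" by blast
    then have "greedy D (insert c H) (f(c := j)) (Suc j)"
      using x first by (intro greedy_extend[OF g, of x]) auto
    then show ?thesis by blast
  next
    case False
    then have "greedy D H f (Suc j)" by (intro greedy_skip[OF g]) blast
    then show ?thesis by blast
  qed
qed

section \<open>Counting skipped vertices against embedded leaves\<close>

lemma descendants_inside:
  assumes g: "greedy D H f m"
    and closed: "\<And>x c. x \<in> H \<Longrightarrow> i < f x \<Longrightarrow> f x < j \<Longrightarrow> (x, c) \<in> E \<Longrightarrow> c \<in> H \<and> f c < j"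
    and y: "y \<in> H" "i < f y" "f y < j"
    and "(y, z) \<in> E\<^sup>*"
  shows "z \<in> H \<and> f y \<le> f z \<and> f z < j"
  using assms(6)
proof (induction rule: rtrancl_induct)
  case base
  show ?case using y by simp
next
  case (step z w)
  then have "w \<in> H \<and> f w < j" using closed[of z w] y by auto
  moreover from this step greedyD(7)[OF g] have "f z < f w" by blast
  ultimately show ?case using step.IH by simp
qed

text \<open>Each position in \<open>S\<close> holds a node whose parent is at \<open>i\<close> or
  earlier. By \<open>closed\<close>, its branch never leaves the stretch between \<open>i\<close>
  and \<open>j\<close>. Two such branches cannot be nested, so choosing a leaf below each node is
  injective.\<close>

lemma card_greedy_choices_le_leaves:
  assumes g: "greedy D H f m"
    and closed: "\<And>x c. x \<in> H \<Longrightarrow> i < f x \<Longrightarrow> f x < j \<Longrightarrow> (x, c) \<in> E \<Longrightarrow> c \<in> H \<and> f c < j"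
    and top: "\<And>l. l \<in> S \<Longrightarrow> \<exists>u y. (u, y) \<in> E \<and> y \<in> H \<and> f y = l \<and> f u \<le> i"
    and S: "S \<subseteq> {i<..<j}"
  shows "card S \<le> card {z \<in> H \<inter> leaves. i < f z \<and> f z < j}"
proof -
  from top obtain U Y where
    Y: "\<And>l. l \<in> S \<Longrightarrow> (U l, Y l) \<in> E \<and> Y l \<in> H \<and> f (Y l) = l \<and> f (U l) \<le> i"
    by metis
  have "\<exists>z. z \<in> leaves \<and> (Y l, z) \<in> E\<^sup>*" if "l \<in> S" for l
  proof -
    have "Y l \<in> V" "Y l \<noteq> r" using Y[OF that] E_subset root_no_parent by auto
    then show ?thesis using ex_leaf_below by blast
  qed
  then obtain Z where Z: "\<And>l. l \<in> S \<Longrightarrow> Z l \<in> leaves \<and> (Y l, Z l) \<in> E\<^sup>*"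
    by metis
  have inside: "z \<in> H \<and> l \<le> f z \<and> f z < j" if "l \<in> S" "(Y l, z) \<in> E\<^sup>*" for l z
  proof -
    have l: "Y l \<in> H" "f (Y l) = l" using Y[OF that(1)] by auto
    have lj: "i < f (Y l)" "f (Y l) < j" using l that(1) S by auto
    have "z \<in> H \<and> f (Y l) \<le> f z \<and> f z < j"
      by (rule descendants_inside[OF g _ l(1) lj that(2)]) (rule closed)
    then show ?thesis using l by simp
  qed
  have no_nesting: "l = l'" if "l \<in> S" "l' \<in> S" "(Y l, Y l') \<in> E\<^sup>*" for l l'
  proof (rule ccontr)
    assume "l \<noteq> l'"
    then have "Y l \<noteq> Y l'" using Y that by metis
    with that(3) obtain w where w: "(Y l, w) \<in> E\<^sup>*" "(w, Y l') \<in> E" by (metis rtranclE)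
    \<comment> \<open>\<open>w\<close> must be the parent \<open>U l'\<close>, which is placed at
      \<open>i\<close> or earlier, although as a descendant of \<open>Y l\<close> it lies beyond
      \<open>i\<close>.\<close>
    from Y[OF that(2)] w(2) parent_unique have "f w \<le> i" by metis
    with inside[OF that(1) w(1)] S that(1) show False by auto
  qed
  have "inj_on Z S"
  proof (rule inj_onI)
    fix l l' assume l: "l \<in> S" "l' \<in> S" "Z l = Z l'"
    then have "(Y l, Y l') \<in> E\<^sup>* \<or> (Y l', Y l) \<in> E\<^sup>*"
      using Z ancestors_comparable by metis
    then show "l = l'" using no_nesting l by metis
  qed
  moreover have "Z ` S \<subseteq> {z \<in> H \<inter> leaves. i < f z \<and> f z < j}"
  proof
    fix z assume "z \<in> Z ` S"
    then obtain l where l: "l \<in> S" "z = Z l" by blast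
    with Z inside[OF l(1), of z] S show "z \<in> {z \<in> H \<inter> leaves. i < f z \<and> f z < j}"
      by fastforce
  qed
  moreover have "finite {z \<in> H \<inter> leaves. i < f z \<and> f z < j}"
    using finite_leaves by simp
  ultimately show ?thesis by (rule card_inj_on_le)
qed

text \<open>Strong induction on the prefix length. When the last vertex \<open>k\<close> is skipped,
  the prefix is cut after the last position \<open>i\<close> whose node still misses a child at time
  \<open>k\<close>. The induction hypothesis bounds the part up to \<open>i\<close>; the
  half-domination property at \<open>i\<close> and \<open>k\<close> bounds the rest.\<close>

lemma card_skipped_le_leaves:
  assumes g: "greedy D H f m"
    and half: "\<And>i j. i < j \<Longrightarrow> j < m \<Longrightarrow> j - i \<le> 2 * card {l \<in> {i<..j}. D i l}"
    and incomplete: "H \<noteq> V"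
    and "j \<le> m"
  shows "card ({..<j} - f ` H) \<le> card {z \<in> H \<inter> leaves. f z < j}"
  using assms(4)
proof (induction j rule: less_induct)
  case (less j)
  have fin: "finite {z \<in> H \<inter> leaves. P z}" for P using finite_leaves by simp
  show ?case
  proof (cases j)
    case 0
    then show ?thesis by simp
  next
    case (Suc k)
    show ?thesis
    proof (cases "k \<in> f ` H")
      case True
      then have "card ({..<j} - f ` H) = card ({..<k} - f ` H)"
        using Suc by (simp add: lessThan_Suc insert_Diff_if)
      also have "\<dots> \<le> card {z \<in> H \<inter> leaves. f z < k}" using less Suc by simp
      also have "\<dots> \<le> card {z \<in> H \<inter> leaves. f z < j}"
        using Suc by (intro card_mono fin) auto
      finally show ?thesis .
    next
      case k_skipped: False
      \<comment> \<open>\<open>P\<close> is the state of the embedding when \<open>k\<close> is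
        processed; a child placed only after \<open>k\<close> still counts as missing. Since
        \<open>H\<close> is incomplete, some node of \<open>P\<close> always misses one.\<close>
      define P where "P = {x \<in> H. f x < k}"
      let ?Q = "\<lambda>x. x \<in> P \<and> (\<exists>c. (x, c) \<in> E \<and> c \<notin> P)"
      have "k \<noteq> 0" using k_skipped greedyD(2,3)[OF g] by force
      then have "r \<in> P" using greedyD(2,3)[OF g] by (simp add: P_def)
      moreover have "P \<subseteq> V" "P \<noteq> V"
        using greedyD(1)[OF g] incomplete by (auto simp: P_def)
      ultimately obtain x0 where "?Q x0" using proper_part_has_missing_child by blast
      moreover have "\<forall>y. ?Q y \<longrightarrow> f y < k" by (simp add: P_def)
      ultimately have "\<exists>x. ?Q x \<and> (\<forall>y. ?Q y \<longrightarrow> f y \<le> f x)"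
        by (intro ex_has_greatest_nat[of ?Q x0 f k]) auto
      then obtain x where x: "?Q x" and last: "\<And>y. ?Q y \<Longrightarrow> f y \<le> f x" by blast
      define i where "i = f x"
      from x obtain c where c: "(x, c) \<in> E" "c \<notin> P" by blast
      have i: "x \<in> H" "i < k" using x by (auto simp: P_def i_def)
      define S where "S = {l \<in> {i<..k}. D i l}"
      have top: "\<exists>u y. (u, y) \<in> E \<and> y \<in> H \<and> f y = l \<and> f u \<le> i" if "l \<in> S" for l
        unfolding i_def
      proof (rule greedyD(9)[OF g i(1) _ _ _ c(1)])
        show "l < m" using that less.prems Suc by (simp add: S_def)
        show "f x < l" "D (f x) l" using that by (auto simp: S_def i_def)
        show "\<not> (c \<in> H \<and> f c < l)" using that c by (auto simp: S_def P_def)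
      qed
      have S_used: "S \<subseteq> f ` H" using top by blast
      \<comment> \<open>\<open>k\<close> is skipped while \<open>S\<close> consists of used
        positions, so \<open>k\<close> itself drops out.\<close>
      then have S: "S \<subseteq> {i<..<k}"
        using k_skipped by (auto simp: S_def le_less)
      have closed: "c' \<in> H \<and> f c' < k" if "x' \<in> H" "i < f x'" "f x' < k" "(x', c') \<in> E" for x' c'
        using last[of x'] that unfolding P_def i_def by auto
      have leaves_S: "card S \<le> card {z \<in> H \<inter> leaves. i < f z \<and> f z < k}"
        by (rule card_greedy_choices_le_leaves[OF g _ _ S]) (use closed top in blast)+
      have "card ({i<..k} - f ` H) \<le> card ({i<..k} - S)"
        using S_used by (intro card_mono) auto
      also have "\<dots> = (k - i) - card S"
        by (subst card_Diff_subset) (auto simp: S_def)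
      \<comment> \<open>\<open>S\<close> is at least half of the \<open>k - i\<close> positions, so
        its complement is no larger than \<open>S\<close>.\<close>
      also have "\<dots> \<le> card S"
        using half[of i k] i less.prems Suc by (simp add: S_def)
      also note leaves_S
      finally have late: "card ({i<..k} - f ` H) \<le> card {z \<in> H \<inter> leaves. i < f z \<and> f z < k}" .
      have early: "card ({..<Suc i} - f ` H) \<le> card {z \<in> H \<inter> leaves. f z < Suc i}"
        using less i Suc by simp
      have "{..<j} - f ` H = ({..<Suc i} - f ` H) \<union> ({i<..k} - f ` H)"
        using Suc i by auto
      then have "card ({..<j} - f ` H) \<le> card ({..<Suc i} - f ` H) + card ({i<..k} - f ` H)"
        by (simp add: card_Un_le)
      also have "\<dots> \<le> card {z \<in> H \<inter> leaves. f z < Suc i}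
          + card {z \<in> H \<inter> leaves. i < f z \<and> f z < k}"
        using early late by simp
      also have "\<dots> = card ({z \<in> H \<inter> leaves. f z < Suc i}
          \<union> {z \<in> H \<inter> leaves. i < f z \<and> f z < k})"
        by (rule card_Un_disjoint[symmetric, OF fin fin]) auto
      also have "\<dots> \<le> card {z \<in> H \<inter> leaves. f z < j}"
        using Suc i by (intro card_mono fin) auto
      finally show ?thesis .
    qed
  qed
qed

theorem embeds_in_half_dominating_order:
  assumes m: "m = card V + card leaves - 1" "1 \<le> m"
    and half: "\<And>i j. i < j \<Longrightarrow> j < m \<Longrightarrow> j - i \<le> 2 * card {l \<in> {i<..j}. D i l}"
  shows "\<exists>f. inj_on f V \<and> f ` V \<subseteq> {..<m} \<and> f r = 0 \<and> (\<forall>u v. (u, v) \<in> E \<longrightarrow> D (f u) (f v))"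
proof -
  from m(2) obtain H f where g: "greedy D H f m" using greedy_exists by blast
  have "H = V"
  proof (rule ccontr)
    assume incomplete: "H \<noteq> V"
    then obtain v where v: "v \<in> V" "v \<notin> H" using greedyD(1)[OF g] by blast
    then have "v \<noteq> r" using greedyD(2)[OF g] by blast
    with v obtain z where z: "z \<in> leaves" "(v, z) \<in> E\<^sup>*" using ex_leaf_below by blast
    \<comment> \<open>\<open>H\<close> is closed under parents, so the missing node \<open>v\<close>
      forces the leaf \<open>z\<close> below it to be missing too.\<close>
    have "v \<in> H" if "z \<in> H"
      using z(2) that by (induction rule: converse_rtrancl_induct) (use greedyD(6)[OF g] in auto)
    with v z have "H \<inter> leaves \<subset> leaves" by blast
    then have leaves_lt: "card (H \<inter> leaves) < card leaves"
      using finite_leaves by (simp add: psubset_card_mono)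
    have H_lt: "card H < card V"
      using greedyD(1)[OF g] incomplete finite_V by (simp add: psubset_card_mono psubsetI)
    have "m = card ({..<m} \<inter> f ` H) + card ({..<m} - f ` H)"
      by (metis card_Int_Diff card_lessThan finite_lessThan)
    also have "{..<m} \<inter> f ` H = f ` H" using greedyD(5)[OF g] by auto
    also have "card (f ` H) = card H" using greedyD(4)[OF g] by (rule card_image)
    also have "card ({..<m} - f ` H) \<le> card {z \<in> H \<inter> leaves. f z < m}"
      by (rule card_skipped_le_leaves[OF g half incomplete]) auto
    also have "{z \<in> H \<inter> leaves. f z < m} = H \<inter> leaves"
      using greedyD(5)[OF g] by auto
    \<comment> \<open>At least one node and one leaf are missing, so used and skipped positions
      together number at most \<open>m - 1\<close>.\<close>
    finally show False using leaves_lt H_lt m by linarith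
  qed
  with greedyD[OF g] E_subset show ?thesis by (intro exI[of _ f]) blast
qed

end

section \<open>Out-arborescences\<close>

lemma mk_symmetric_arcs_iff:
  "(a, b) \<in> parcs (mk_symmetric (with_proj G)) \<longleftrightarrow> (a, b) \<in> parcs G \<or> (b, a) \<in> parcs G"
proof
  assume "(a, b) \<in> parcs G \<or> (b, a) \<in> parcs G"
  then show "(a, b) \<in> parcs (mk_symmetric (with_proj G))"
    by (auto simp: mk_symmetric_def intro: bexI[of _ "(a, b)"] bexI[of _ "(b, a)"])
qed (auto simp: mk_symmetric_def)

lemma mk_symmetric_verts: "pverts (mk_symmetric (with_proj G)) = pverts G"
  by (simp add: mk_symmetric_def)

text \<open>Going back along \<open>q\<close> to \<open>r\<close> and then forward along
  \<open>p\<close> leads from \<open>u'\<close> to \<open>u\<close> without meeting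
  \<open>v\<close>. Shortened to a path and closed through \<open>v\<close>, this is a
  cycle.\<close>

lemma (in pair_sym_digraph) cycle_if_two_apaths:
  assumes p: "apath r (p @ [(u, v)]) v" and q: "apath r (q @ [(u', v)]) v" and "u \<noteq> u'"
  shows "\<exists>c. cycle c \<and> 3 \<le> length c"
proof -
  have split: "awalk r s a" "(a, v) \<in> parcs G" "v \<notin> set (pawalk_verts r s)"
    if "apath r (s @ [(a, v)]) v" for s a
  proof -
    from that have *: "apath r s (awlast r s)" "apath (awlast r s) [(a, v)] v"
      "set (awalk_verts r s) \<inter> set (tl (awalk_verts (awlast r s) [(a, v)])) = {}"
      unfolding apath_append_iff by auto
    then show "awalk r s a" "(a, v) \<in> parcs G" "v \<notin> set (pawalk_verts r s)"
      by (auto simp: apath_def awalk_simps)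
  qed
  note P = split[OF p] and Q = split[OF q]
  define w where "w = awalk_to_apath (rev_path q @ p)"
  have q_back: "awalk u' (rev_path q) r" using Q by simp
  then have walk: "awalk u' (rev_path q @ p) u" using P(1) by (rule awalk_appendI)
  then have path: "apath u' w u" unfolding w_def by (rule apath_awalk_to_apath)
  have "v \<notin> set (pawalk_verts u' (rev_path q @ p))"
    using set_awalk_verts_append[OF q_back P(1)] P Q by (simp add: awalk_verts_rev_path)
  moreover have "set w \<subseteq> set (rev_path q @ p)"
    unfolding w_def using walk by (rule awalk_to_apath_subset)
  moreover have "awalk u' w u" using path by (simp add: apath_def)
  ultimately have "v \<notin> set (pawalk_verts u' w)"
    using set_awalk_verts[OF walk] set_awalk_verts[of u' w u] by auto
  moreover have "w \<noteq> []" using path \<open>u \<noteq> u'\<close> by (auto simp: apath_Nil_iff)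
  moreover have "(v, u') \<in> parcs G" using Q(2) by (rule arcs_symmetric)
  ultimately have "cycle ((u, v) # (v, u') # w)"
    using path P(2) unfolding cycle_def apath_def by (auto simp: awalk_Cons_iff)
  \<comment> \<open>\<open>u\<close> and \<open>u'\<close> differ, so \<open>w\<close> contributes
    at least one arc to the two through \<open>v\<close>.\<close>
  moreover have "3 \<le> length ((u, v) # (v, u') # w)" using \<open>w \<noteq> []\<close> by (cases w) auto
  ultimately show ?thesis by blast
qed

text \<open>Two parents of one node would give a cycle of the underlying graph, since both arcs
  point away from \<open>r\<close>. Directed reachability follows by induction along an undirected
  walk from \<open>r\<close>.\<close>

lemma out_arborescence_rooted_tree:
  assumes "out_arborescence A r"
  shows "rooted_tree (pverts A) (parcs A) r"
proof -
  let ?S = "mk_symmetric (with_proj A)"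
  from assms have dg: "pair_digraph A" and con: "connected (with_proj A)"
    and acyc: "\<not> (\<exists>p. pre_digraph.cycle (with_proj ?S) p \<and> 3 \<le> length p)"
    and r: "r \<in> pverts A"
    and away: "\<And>u v. (u, v) \<in> parcs A \<Longrightarrow>
      \<exists>p. pre_digraph.apath (with_proj ?S) r (p @ [(u, v)]) v"
    by (auto simp: out_arborescence_def oriented_tree_def oriented_graph_def)
  interpret A: pair_digraph A by (rule dg)
  interpret S: pair_sym_digraph ?S
    by unfold_locales
      (auto simp: mk_symmetric_arcs_iff mk_symmetric_verts symmetric_def sym_def
        dest: A.in_arcsD1 A.in_arcsD2)
  have unique: "u = u'" if "(u, v) \<in> parcs A" "(u', v) \<in> parcs A" for u u' v
    using away[OF that(1)] away[OF that(2)] S.cycle_if_two_apaths acyc by blast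
  have no_parent: "(u, r) \<notin> parcs A" for u
  proof
    assume "(u, r) \<in> parcs A"
    then obtain p where "S.apath r (p @ [(u, r)]) r" using away by blast
    then show False using S.apath_nonempty_ends by blast
  qed
  have reach: "(r, v) \<in> (parcs A)\<^sup>*" if "v \<in> pverts A" for v
  proof -
    have "r \<rightarrow>\<^sup>*\<^bsub>with_proj ?S\<^esub> v"
      using con that r by (auto simp: connected_def strongly_connected_def mk_symmetric_verts)
    then have "(r, v) \<in> (parcs ?S)\<^sup>*"
      unfolding reachable_def by (metis rtrancl_on_rtranclI with_proj_simps(3))
    then show ?thesis
    proof (induction rule: rtrancl_induct)
      case base
      show ?case by simp
    next
      case (step y z)
      show ?case
      proof (cases "(y, z) \<in> parcs A")
        case True
        with step.IH show ?thesis by simp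
      next
        case False
        with step.hyps have zy: "(z, y) \<in> parcs A" by (simp add: mk_symmetric_arcs_iff)
        \<comment> \<open>The walk goes backwards along \<open>(z, y)\<close>. The directed path to
          \<open>y\<close> is not empty, as \<open>r\<close> has no parent, and its last arc comes
          from the unique parent \<open>z\<close>, so \<open>z\<close> was already reached.\<close>
        from step.IH show ?thesis
        proof (cases rule: rtranclE)
          case base
          with zy no_parent show ?thesis by simp
        next
          case (step w)
          with zy unique show ?thesis by metis
        qed
      qed
    qed
  qed
  show ?thesis
    using A.pair_finite_verts r reach unique no_parent
    by unfold_locales (auto dest: A.in_arcsD1 A.in_arcsD2)
qed

lemma (in rooted_tree) leaves_eq_out_leaves:
  assumes "pverts A = V" "parcs A = E"
  shows "out_leaves A = leaves"
proof -
  have finite_E: "finite E" using finite_subset[OF E_subset] finite_V by simp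
  have "in_degree (with_proj A) v = 1 \<longleftrightarrow> v \<noteq> r" if "v \<in> V" for v
  proof
    assume "in_degree (with_proj A) v = 1"
    then obtain e where "in_arcs (with_proj A) v = {e}"
      by (auto simp: in_degree_def card_1_singleton_iff)
    then have "e \<in> in_arcs (with_proj A) v" by simp
    then have "(fst e, v) \<in> E" using assms by (auto simp: in_arcs_def)
    then show "v \<noteq> r" using root_no_parent by blast
  next
    assume "v \<noteq> r"
    with reachable_from_root[OF that] obtain u where "(u, v) \<in> E" by (metis rtranclE)
    then have "in_arcs (with_proj A) v = {(u, v)}"
      using assms by (auto simp: in_arcs_def intro: parent_unique)
    then show "in_degree (with_proj A) v = 1" by (simp add: in_degree_def)
  qed
  moreover have "out_degree (with_proj A) v = 0 \<longleftrightarrow> (\<forall>c. (v, c) \<notin> E)" for v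
    using finite_E assms by (auto simp: out_degree_def out_arcs_def)
  ultimately show ?thesis using assms by (auto simp: out_leaves_def leaves_def)
qed

theorem mainTheorem7:
  fixes A :: "'a pair_pre_digraph" and r :: 'a
    and T :: "'b pair_pre_digraph" and \<sigma> :: "'b list"
    and n k m :: nat
  assumes "out_arborescence A r"
    and "card (pverts A) = n"
    and "card (out_leaves A) = k"
    and "m = n + k - 1"
    and "m \<ge> 1"
    and "tournament_on m T"
    and "local_median_order T \<sigma>"
  shows "\<exists>\<phi>. embedding A T \<phi> \<and> \<phi> r = \<sigma> ! 0"
proof -
  interpret rooted_tree "pverts A" "parcs A" r
    using assms(1) by (rule out_arborescence_rooted_tree)
  have \<sigma>: "distinct \<sigma>" "set \<sigma> = pverts T"
    using assms(7) by (auto simp: local_median_order_def)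
  have "card (pverts T) = m"
    using assms(6) by (simp add: tournament_on_def complete_digraph_def mk_symmetric_verts)
  then have len: "length \<sigma> = m" using \<sigma> by (metis distinct_card)
  define D where "D i l \<longleftrightarrow> (\<sigma> ! i, \<sigma> ! l) \<in> parcs T" for i l
  have "j - i \<le> 2 * card {l \<in> {i<..j}. D i l}" if "i < j" "j < m" for i j
  proof -
    have "real (card {i<..j}) / 2 \<le> real (card {l \<in> {i<..j}. D i l})"
      using assms(7) that len unfolding local_median_order_def D_def by blast
    then show ?thesis by simp
  qed
  then obtain f where f: "inj_on f (pverts A)" "f ` pverts A \<subseteq> {..<m}" "f r = 0"
    "\<And>u v. (u, v) \<in> parcs A \<Longrightarrow> D (f u) (f v)"
    using embeds_in_half_dominating_order[of m D] assms(2-5) leaves_eq_out_leaves[of A] by auto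
  define \<phi> where "\<phi> x = \<sigma> ! f x" for x
  have "\<phi> ` pverts A \<subseteq> pverts T"
    using f(2) \<sigma>(2) len unfolding \<phi>_def by (metis image_subset_iff lessThan_iff nth_mem)
  moreover have "inj_on \<phi> (pverts A)"
    using f(1,2) \<sigma>(1) len unfolding \<phi>_def inj_on_def
    by (metis image_subset_iff lessThan_iff nth_eq_iff_index_eq)
  moreover have "(\<phi> u, \<phi> v) \<in> parcs T" if "(u, v) \<in> parcs A" for u v
    using f(4)[OF that] by (simp add: \<phi>_def D_def)
  ultimately show ?thesis using f(3) by (intro exI[of _ \<phi>]) (auto simp: embedding_def \<phi>_def)
qed

end
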